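(* Let $m\in C_K$, $m\ne0$, let $\rho=-\theta_0-p-\frac{r'}{2r}$, $\nu=mr-\rho\theta_0$, $P_m=\frac1{\sqrt r}\begin{pmatrix}-\theta_0&1\\ \nu&\rho\end{pmatrix}$, $\Delta=\begin{pmatrix}1&0\\0&w\end{pmatrix}$, and let $P_{2,m}:=\mathrm{Sym}^2(\Delta P_m\Delta^{-1})$. Then $$P_{2,m}=\frac1r\begin{pmatrix}\theta_0^2&-\frac{\theta_0}{w}&\frac1{w^2}\\-2w\theta_0\nu&\nu-\rho\theta_0&\frac{2\rho}{w}\\ w^2\nu^2&w\rho\nu&\rho^2\end{pmatrix}=\frac1r\begin{pmatrix}0&0&1\\0&wmr&2w\rho\\ w^2m^2r^2&w^2\rho mr&w^2\rho^2\end{pmatrix}\begin{pmatrix}1&0&0\\-2\theta_0&\frac1w&0\\ \theta_0^2&-\frac{\theta_0}{w}&\frac1{w^2}\end{pmatrix},$$ and $P_{2,m}$ is a Darboux transformation for the system $Y_1'=-(\widehat S_2+m\widehat N_2)Y_1$, i.e., the gauge transformation $\widetilde Y_1=P_{2,m}Y_1$ sends it to the system $\widetilde Y_1'=-(\widetilde{\widehat S}_2+m\widehat N_2)\widetilde Y_1$ of the same shape, with $q$ replaced by $\tilde q$.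
   Context: $K$ is a differential field of characteristic zero with algebraically closed field of constants $C_K$. Let $p,q,r\in K$, $r\neq0$, $p=w'/w$ for a fixed nonzero $w\in K$. Let $y_0$ be a nonzero solution of $y''+py'+qy=0$ (in a Picard--Vessiot extension of $K$), $\theta_0:=y_0'/y_0$, $\sqrt r$ a square root of $r$, and $$\tilde q:=y_0\sqrt r\left(\frac{p}{y_0\sqrt r}-\Big(\frac1{y_0\sqrt r}\Big)'\right)'.$$ Set $$\widehat S_2=\begin{pmatrix}0&-\frac1w&0\\2wq&0&-\frac2w\\0&wq&0\end{pmatrix},\quad \widetilde{\widehat S}_2=\begin{pmatrix}0&-\frac1w&0\\2w\tilde q&0&-\frac2w\\0&w\tilde q&0\end{pmatrix},\quad \widehat N_2=\begin{pmatrix}0&0&0\\-2wr&0&0\\0&-wr&0\end{pmatrix}.$$ The system $Y_1'=-(\widehat S_2+m\widehat N_2)Y_1$ is the second symmetric power of the system satisfied by $(y,wy')^{\rm T}$ when $y''+py'+(q-mr)y=0$. The second symmetric power (in the sense of groups) of a $2\times2$ matrix is $$\mathrm{Sym}^2\begin{pmatrix}a&b\\ c&d\end{pmatrix}=\begin{pmatrix}a^2&ab&b^2\\2ac&ad+bc&2bd\\ c^2&cd&d^2\end{pmatrix}.$$ A gauge transformation is an invertible linear change of the unknown vector. *)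

theory Defs
  imports "HOL-Computational_Algebra.Polynomial" "Jordan_Normal_Form.Gauss_Jordan_Elimination"
begin

text \<open>
  Differential fields are modelled inside an ambient field \<open>'a\<close> of characteristic zero with a
  derivation \<open>D\<close>: the base field and its extensions are subsets of \<open>'a\<close> that are subfields
  stable under \<open>D\<close>.
\<close>

definition derivation :: "('a::field_char_0 \<Rightarrow> 'a) \<Rightarrow> bool" where
  "derivation D \<longleftrightarrow>
     (\<forall>x y. D (x + y) = D x + D y) \<and> (\<forall>x y. D (x * y) = D x * y + x * D y)"

definition differential_subfield :: "('a::field_char_0 \<Rightarrow> 'a) \<Rightarrow> 'a set \<Rightarrow> bool" where
  "differential_subfield D K \<longleftrightarrow>
     0 \<in> K \<and> 1 \<in> K \<and>
     (\<forall>x\<in>K. \<forall>y\<in>K. x + y \<in> K \<and> x * y \<in> K) \<and>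
     (\<forall>x\<in>K. - x \<in> K \<and> inverse x \<in> K \<and> D x \<in> K)"

definition constants :: "('a::field_char_0 \<Rightarrow> 'a) \<Rightarrow> 'a set \<Rightarrow> 'a set" where
  "constants D K = {c \<in> K. D c = 0}"

definition alg_closed_subfield :: "'a::field_char_0 set \<Rightarrow> bool" where
  "alg_closed_subfield C \<longleftrightarrow>
     (\<forall>f::'a poly. set (coeffs f) \<subseteq> C \<and> degree f > 0 \<longrightarrow> (\<exists>x\<in>C. poly f x = 0))"

text \<open>
  \<open>L\<close> is generated over \<open>K\<close> by the entries of a fundamental matrix of some linear differential
  system \<open>F' = A F\<close> with coefficients in \<open>K\<close>, and has no new constants.  An intersection of
  differential subfields is one, so the hull below is the differential subfield generated.
\<close>

definition picard_vessiot_extension ::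
    "('a::field_char_0 \<Rightarrow> 'a) \<Rightarrow> 'a set \<Rightarrow> 'a set \<Rightarrow> bool" where
  "picard_vessiot_extension D K L \<longleftrightarrow>
     differential_subfield D K \<and> differential_subfield D L \<and> K \<subseteq> L \<and>
     constants D L = constants D K \<and>
     (\<exists>n A F. A \<in> carrier_mat n n \<and> elements_mat A \<subseteq> K \<and>
        F \<in> carrier_mat n n \<and> invertible_mat F \<and> map_mat D F = A * F \<and>
        L = differential_subfield D hull (K \<union> elements_mat F))"

abbreviation mat_inv :: "'a::field mat \<Rightarrow> 'a mat" where
  "mat_inv A \<equiv> the (mat_inverse A)"

definition is_solution :: "('a::field_char_0 \<Rightarrow> 'a) \<Rightarrow> 'a mat \<Rightarrow> 'a vec \<Rightarrow> bool" where
  "is_solution D A Y \<longleftrightarrow> Y \<in> carrier_vec (dim_col A) \<and> map_vec D Y = A *\<^sub>v Y"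

text \<open>
  The change of unknown \<open>Z = P Y\<close> turns the system \<open>Y' = A Y\<close> into \<open>Z' = (P' + P A) P\<inverse> Z\<close>.
\<close>

definition gauge_transform :: "('a::field_char_0 \<Rightarrow> 'a) \<Rightarrow> 'a mat \<Rightarrow> 'a mat \<Rightarrow> 'a mat" where
  "gauge_transform D P A = (map_mat D P + P * A) * mat_inv P"

definition Sym2 :: "'a::field_char_0 mat \<Rightarrow> 'a mat" where
  "Sym2 M =
     (let a = M $$ (0,0); b = M $$ (0,1); c = M $$ (1,0); d = M $$ (1,1) in
      mat_of_rows_list 3
        [[a\<^sup>2,       a * b,         b\<^sup>2],
         [2 * a * c, a * d + b * c, 2 * b * d],
         [c\<^sup>2,       c * d,         d\<^sup>2]])"

definition S2_hat :: "'a::field_char_0 \<Rightarrow> 'a \<Rightarrow> 'a mat" where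
  "S2_hat w q = mat_of_rows_list 3
     [[0,         - 1 / w, 0],
      [2 * w * q, 0,       - 2 / w],
      [0,         w * q,   0]]"

definition N2_hat :: "'a::field_char_0 \<Rightarrow> 'a \<Rightarrow> 'a mat" where
  "N2_hat w r = mat_of_rows_list 3
     [[0,           0,       0],
      [- 2 * w * r, 0,       0],
      [0,           - w * r, 0]]"

definition sym2_system :: "'a::field_char_0 \<Rightarrow> 'a \<Rightarrow> 'a \<Rightarrow> 'a \<Rightarrow> 'a mat" where
  "sym2_system w q r m = - (S2_hat w q + m \<cdot>\<^sub>m N2_hat w r)"

end

theory Submission
  imports Defs "Jordan_Normal_Form.Determinant"
begin

text \<open>
  A gauge transformation by \<open>P\<close> carries \<open>Y' = A Y\<close> to \<open>Z' = B Z\<close> iff \<open>P' + P A = B P\<close>.  For the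
  \<open>2 \<times> 2\<close> companion systems this says that \<open>y \<mapsto> (y' - \<theta>0 y) / sr\<close> is the classical Darboux
  transformation; it holds because \<open>\<rho>\<close> is the logarithmic derivative of \<open>u = 1 / (w y0 sr)\<close> and
  \<open>u'' + p u' + qt u = 0\<close>.  By the product rule the relation is inherited by symmetric squares,
  and \<open>det Pm = - m\<close> gives invertibility because \<open>Sym2\<close> is multiplicative.
\<close>

section \<open>Calculus of derivations on a field\<close>

lemma derivation_add: "derivation D \<Longrightarrow> D (x + y) = D x + D y"
  by (simp add: derivation_def)

lemma derivation_mult: "derivation D \<Longrightarrow> D (x * y) = D x * y + x * D y"
  by (simp add: derivation_def)

lemma derivation_0: "derivation D \<Longrightarrow> D 0 = 0"
  using derivation_add[of D 0 0] by simp

lemma derivation_1: "derivation D \<Longrightarrow> D 1 = 0"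
  using derivation_mult[of D 1 1] by simp

lemma derivation_minus: "derivation D \<Longrightarrow> D (- x) = - D x"
  using derivation_add[of D x "- x"] by (simp add: derivation_0 eq_neg_iff_add_eq_0 add.commute)

lemma derivation_diff: "derivation D \<Longrightarrow> D (x - y) = D x - D y"
  using derivation_add[of D x "- y"] by (simp add: derivation_minus)

text \<open>Product rule applied to \<open>(x / y) * y\<close>. The quotient is kept inside the
  result, so only a single power of \<open>y\<close> appears in the denominator.\<close>

lemma derivation_divide:
  assumes "derivation D" and "y \<noteq> 0"
  shows "D (x / y) = (D x - (x / y) * D y) / y"
proof -
  have "D x = D (x / y) * y + (x / y) * D y"
    using derivation_mult[OF assms(1), of "x / y" y] assms(2) by simp
  then show ?thesis using assms(2) by (simp add: field_simps)
qed

lemma derivation_sum: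
  assumes "derivation D"
  shows "D (\<Sum>i\<in>I. f i) = (\<Sum>i\<in>I. D (f i))"
  by (induction I rule: infinite_finite_induct)
    (simp_all add: derivation_0[OF assms] derivation_add[OF assms])

section \<open>Matrix inverses and gauge transformations\<close>

lemma derivation_mult_mat_vec:
  assumes "derivation D" and "P \<in> carrier_mat n k" and "Y \<in> carrier_vec k"
  shows "map_vec D (P *\<^sub>v Y) = map_mat D P *\<^sub>v Y + P *\<^sub>v map_vec D Y"
  using assms(2,3)
  by (intro eq_vecI)
    (auto simp: scalar_prod_def derivation_sum[OF assms(1)] derivation_mult[OF assms(1)]
      sum.distrib)

text \<open>Since \<open>mat_inv\<close> is \<open>the\<close> of an option, the value
  \<open>None\<close> has to be excluded: a right inverse of a square matrix is also a left inverse,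
  so \<open>A\<close> is a unit of the matrix ring. Otherwise uniqueness of inverses
  applies.\<close>

lemma mat_inv_eqI:
  fixes A B :: "'a::field mat"
  assumes "A \<in> carrier_mat n n" and "B \<in> carrier_mat n n" and "A * B = 1\<^sub>m n"
  shows "mat_inv A = B"
proof -
  have BA: "B * A = 1\<^sub>m n"
    using mat_mult_left_right_inverse[OF assms] .
  show ?thesis
  proof (cases "mat_inverse A")
    case None
    have "A \<in> Units (ring_mat TYPE('a) n ())"
      using assms BA by (auto simp: Units_def ring_mat_def)
    with mat_inverse(1)[OF assms(1) None, where b = "()"] show ?thesis by blast
  next
    case (Some C)
    from mat_inverse(2)[OF assms(1) Some]
    have C: "C * A = 1\<^sub>m n" "C \<in> carrier_mat n n" by auto
    have "C = C * (A * B)" using C assms by simp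
    also have "\<dots> = (C * A) * B"
      using C(2) assms(1,2) by (simp add: assoc_mult_mat)
    also have "\<dots> = B" using C assms by simp
    finally show ?thesis using Some by simp
  qed
qed

text \<open>Multiplying \<open>P' + P A = B P\<close> by the inverse of \<open>P\<close> on the
  right gives \<open>B\<close>. This needs only some inverse \<open>R\<close>, not its
  entries.\<close>

lemma gauge_transform_eqI:
  assumes "P \<in> carrier_mat n n" and "R \<in> carrier_mat n n" and "P * R = 1\<^sub>m n"
    and "B \<in> carrier_mat n n" and "map_mat D P + P * A = B * P"
  shows "gauge_transform D P A = B"
  unfolding gauge_transform_def assms(5) mat_inv_eqI[OF assms(1-3)]
  using assms(1-4) by (simp add: assoc_mult_mat[of _ n n _ n _ n])

text \<open>By the product rule \<open>(P Y)' = P' Y + P Y'\<close>, while the relation for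
  \<open>P\<close> gives \<open>B P Y = P' Y + P A Y\<close>. The common term cancels, and
  \<open>P\<close> is injective because \<open>R\<close> is also a left inverse.\<close>

lemma is_solution_gauge_iff:
  assumes D: "derivation D"
    and P: "P \<in> carrier_mat n n" and R: "R \<in> carrier_mat n n" and PR: "P * R = 1\<^sub>m n"
    and A: "A \<in> carrier_mat n n" and B: "B \<in> carrier_mat n n"
    and PA: "map_mat D P + P * A = B * P"
    and Y: "Y \<in> carrier_vec n"
  shows "is_solution D A Y \<longleftrightarrow> is_solution D B (P *\<^sub>v Y)"
proof -
  have RP: "R * P = 1\<^sub>m n"
    using mat_mult_left_right_inverse[OF P R PR] .
  have DP: "map_mat D P \<in> carrier_mat n n" and DY: "map_vec D Y \<in> carrier_vec n"
    and AY: "A *\<^sub>v Y \<in> carrier_vec n"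
    using P Y A by auto
  have inj: "U = V" if "P *\<^sub>v U = P *\<^sub>v V" "U \<in> carrier_vec n" "V \<in> carrier_vec n" for U V
  proof -
    have "(R * P) *\<^sub>v U = (R * P) *\<^sub>v V"
      using that R P by (simp add: assoc_mult_mat_vec[of R n n P n])
    then show ?thesis using that RP by simp
  qed
  have "B *\<^sub>v (P *\<^sub>v Y) = (map_mat D P + P * A) *\<^sub>v Y"
    unfolding PA using assoc_mult_mat_vec[OF B P Y] by simp
  also have "\<dots> = map_mat D P *\<^sub>v Y + P *\<^sub>v (A *\<^sub>v Y)"
    using add_mult_distrib_mat_vec[OF DP mult_carrier_mat[OF P A] Y]
      assoc_mult_mat_vec[OF P A Y] by simp
  finally have "map_vec D (P *\<^sub>v Y) = B *\<^sub>v (P *\<^sub>v Y) \<longleftrightarrow>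
      map_mat D P *\<^sub>v Y + P *\<^sub>v map_vec D Y = map_mat D P *\<^sub>v Y + P *\<^sub>v (A *\<^sub>v Y)"
    by (simp add: derivation_mult_mat_vec[OF D P Y])
  also have "\<dots> \<longleftrightarrow> P *\<^sub>v map_vec D Y = P *\<^sub>v (A *\<^sub>v Y)"
    using mult_mat_vec_carrier[OF DP Y] mult_mat_vec_carrier[OF P DY]
      mult_mat_vec_carrier[OF P AY]
    by (auto simp: vec_eq_iff)
  also have "\<dots> \<longleftrightarrow> map_vec D Y = A *\<^sub>v Y"
    using inj DY AY by auto
  finally show ?thesis
    using A B P Y by (auto simp: is_solution_def)
qed

section \<open>Explicit matrices of size 2 and 3\<close>

lemma less_3_cases: "(i::nat) < 3 \<Longrightarrow> i = 0 \<or> i = 1 \<or> i = 2"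
  by auto

lemma mat2_eqI:
  assumes "A \<in> carrier_mat 2 2" and "B \<in> carrier_mat 2 2"
    and "A $$ (0,0) = B $$ (0,0)" "A $$ (0,1) = B $$ (0,1)"
        "A $$ (1,0) = B $$ (1,0)" "A $$ (1,1) = B $$ (1,1)"
  shows "A = B"
  using assms by (intro eq_matI) (auto dest!: less_2_cases)

lemma mat3_eqI:
  assumes "A \<in> carrier_mat 3 3" and "B \<in> carrier_mat 3 3"
    and "A $$ (0,0) = B $$ (0,0)" "A $$ (0,1) = B $$ (0,1)" "A $$ (0,2) = B $$ (0,2)"
        "A $$ (1,0) = B $$ (1,0)" "A $$ (1,1) = B $$ (1,1)" "A $$ (1,2) = B $$ (1,2)"
        "A $$ (2,0) = B $$ (2,0)" "A $$ (2,1) = B $$ (2,1)" "A $$ (2,2) = B $$ (2,2)"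
  shows "A = B"
  using assms by (intro eq_matI) (auto dest!: less_3_cases)

lemma mat_of_rows_list_2:
  "mat_of_rows_list 2 [[a, b], [c, d]] \<in> carrier_mat 2 2"
  "mat_of_rows_list 2 [[a, b], [c, d]] $$ (0,0) = a"
  "mat_of_rows_list 2 [[a, b], [c, d]] $$ (0,1) = b"
  "mat_of_rows_list 2 [[a, b], [c, d]] $$ (1,0) = c"
  "mat_of_rows_list 2 [[a, b], [c, d]] $$ (1,1) = d"
  by (simp_all add: mat_of_rows_list_def numeral_2_eq_2)

lemma mat_of_rows_list_3:
  "mat_of_rows_list 3 [[a, b, c], [d, e, f], [g, h, i]] \<in> carrier_mat 3 3"
  "mat_of_rows_list 3 [[a, b, c], [d, e, f], [g, h, i]] $$ (0,0) = a"
  "mat_of_rows_list 3 [[a, b, c], [d, e, f], [g, h, i]] $$ (0,1) = b"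
  "mat_of_rows_list 3 [[a, b, c], [d, e, f], [g, h, i]] $$ (0,2) = c"
  "mat_of_rows_list 3 [[a, b, c], [d, e, f], [g, h, i]] $$ (1,0) = d"
  "mat_of_rows_list 3 [[a, b, c], [d, e, f], [g, h, i]] $$ (1,1) = e"
  "mat_of_rows_list 3 [[a, b, c], [d, e, f], [g, h, i]] $$ (1,2) = f"
  "mat_of_rows_list 3 [[a, b, c], [d, e, f], [g, h, i]] $$ (2,0) = g"
  "mat_of_rows_list 3 [[a, b, c], [d, e, f], [g, h, i]] $$ (2,1) = h"
  "mat_of_rows_list 3 [[a, b, c], [d, e, f], [g, h, i]] $$ (2,2) = i"
  by (simp_all add: mat_of_rows_list_def numeral_2_eq_2 numeral_3_eq_3)

lemma mult_mat_2_index: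
  assumes "A \<in> carrier_mat 2 2" and "B \<in> carrier_mat 2 2" and "i < 2" and "j < 2"
  shows "(A * B) $$ (i,j) = A $$ (i,0) * B $$ (0,j) + A $$ (i,1) * B $$ (1,j)"
  using assms by (auto simp: scalar_prod_def numeral_2_eq_2)

lemma mult_mat_3_index:
  assumes "A \<in> carrier_mat 3 3" and "B \<in> carrier_mat 3 3" and "i < 3" and "j < 3"
  shows "(A * B) $$ (i,j) =
    A $$ (i,0) * B $$ (0,j) + A $$ (i,1) * B $$ (1,j) + A $$ (i,2) * B $$ (2,j)"
  using assms by (auto simp: scalar_prod_def numeral_3_eq_3 numeral_2_eq_2)

lemma mult_mat_of_rows_list_2:
  "mat_of_rows_list 2 [[a, b], [c, d]] * mat_of_rows_list 2 [[a', b'], [c', d']] =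
   mat_of_rows_list 2 [[a * a' + b * c', a * b' + b * d'], [c * a' + d * c', c * b' + d * d']]"
  by (rule mat2_eqI)
    (simp_all add: mult_mat_2_index mult_carrier_mat[of _ 2 2] mat_of_rows_list_2[simplified])

lemma one_mat_2: "1\<^sub>m 2 = mat_of_rows_list 2 [[1, 0], [0, 1]]"
  by (rule mat2_eqI) (simp_all add: mat_of_rows_list_2[simplified])

section \<open>Symmetric squares and their linear systems\<close>

lemma Sym2_mat_of_rows_list:
  "Sym2 (mat_of_rows_list 2 [[a, b], [c, d]]) = mat_of_rows_list 3
     [[a\<^sup>2, a * b, b\<^sup>2], [2 * a * c, a * d + b * c, 2 * b * d], [c\<^sup>2, c * d, d\<^sup>2]]"
  by (simp add: Sym2_def Let_def mat_of_rows_list_2[simplified])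

lemma Sym2_carrier: "Sym2 M \<in> carrier_mat 3 3"
  by (simp add: Sym2_def Let_def mat_of_rows_list_3)

lemma Sym2_one: "Sym2 (1\<^sub>m 2) = 1\<^sub>m 3"
  unfolding one_mat_2 Sym2_mat_of_rows_list
  by (rule mat3_eqI) (simp_all add: mat_of_rows_list_3[simplified])

text \<open>\<open>Sym2 M\<close> is the matrix by which \<open>(x * x, 2 * x * y, y * y)\<close>
  changes when \<open>M\<close> is applied to \<open>(x, y)\<close>, hence it respects
  composition.\<close>

lemma Sym2_mult:
  assumes "A \<in> carrier_mat 2 2" and "B \<in> carrier_mat 2 2"
  shows "Sym2 (A * B) = Sym2 A * Sym2 B"
proof (rule mat3_eqI)
  show "Sym2 A * Sym2 B \<in> carrier_mat 3 3"
    by (rule mult_carrier_mat[OF Sym2_carrier Sym2_carrier])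
qed (use assms in \<open>simp_all add: Sym2_carrier mult_mat_3_index
      Sym2_def Let_def mat_of_rows_list_3[simplified] mult_mat_2_index[simplified] power2_eq_square
      algebra_simps del: index_mult_mat\<close>)

text \<open>This exhibits the symmetric square of \<open>(0, h; -k, 0)\<close> with
  \<open>h = 1 / w\<close> and \<open>k = w * (q - m * r)\<close>, the companion system of
  \<open>(y, w * y')\<close>.\<close>

lemma sym2_system_eq:
  "sym2_system w q r m = mat_of_rows_list 3
     [[0, 1 / w, 0],
      [- 2 * (w * (q - m * r)), 0, 2 * (1 / w)],
      [0, - (w * (q - m * r)), 0]]"
  by (rule mat3_eqI)
    (auto simp: sym2_system_def S2_hat_def N2_hat_def mat_of_rows_list_def
      numeral_2_eq_2 numeral_3_eq_3 algebra_simps)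

text \<open>
  The hypotheses are the entries of \<open>M' + M A = B M\<close> for \<open>A = (0, h; -k, 0)\<close> and
  \<open>B = (0, h; -l, 0)\<close>.
\<close>

lemma Sym2_intertwining:
  assumes D: "derivation D"
    and "D a = h * c + k * b" and "D b = h * d - h * a"
    and "D c = k * d - l * a" and "D d = - l * b - h * c"
  defines "S \<equiv> Sym2 (mat_of_rows_list 2 [[a, b], [c, d]])"
  shows "map_mat D S + S * mat_of_rows_list 3 [[0, h, 0], [- 2 * k, 0, 2 * h], [0, - k, 0]] =
    mat_of_rows_list 3 [[0, h, 0], [- 2 * l, 0, 2 * h], [0, - l, 0]] * S"
    (is "_ + _ * ?A = ?B * _")
proof -
  have S: "S \<in> carrier_mat 3 3" by (simp add: S_def Sym2_carrier)
  have A: "?A \<in> carrier_mat 3 3" and B: "?B \<in> carrier_mat 3 3"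
    by (rule mat_of_rows_list_3)+
  \<comment> \<open>The middle row of \<open>Sym2\<close> carries factors 2, which get
    differentiated as well.\<close>
  have two: "D 2 = 0"
    using derivation_add[OF D, of 1 1] by (simp add: derivation_1[OF D])
  note SA = mult_carrier_mat[OF S A] and BS = mult_carrier_mat[OF B S]
  \<comment> \<open>Product entries stay folded here, so that \<open>prods\<close> can expand them
    into three-term sums instead of scalar products.\<close>
  have DS: "(map_mat D S + S * ?A) $$ (i,j) = D (S $$ (i,j)) + (S * ?A) $$ (i,j)"
    if "i < 3" "j < 3" for i j
    using that S carrier_matD[OF SA] by (simp del: index_mult_mat(1))
  note prods = mult_mat_3_index[OF S A] mult_mat_3_index[OF B S]
  have entries: "S $$ (0,0) = a * a" "S $$ (0,1) = a * b" "S $$ (0,2) = b * b"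
      "S $$ (1,0) = 2 * (a * c)" "S $$ (1,1) = a * d + b * c" "S $$ (1,2) = 2 * (b * d)"
      "S $$ (2,0) = c * c" "S $$ (2,1) = c * d" "S $$ (2,2) = d * d"
    by (simp_all add: S_def Sym2_mat_of_rows_list mat_of_rows_list_3[simplified] power2_eq_square mult.assoc)
  have idx: "(0::nat) < 3" "(1::nat) < 3" "(2::nat) < 3" by simp_all
  have sums: "map_mat D S + S * ?A \<in> carrier_mat 3 3"
    by (rule add_carrier_mat[OF SA])
  show ?thesis
    \<comment> \<open>Once the derivatives of \<open>a\<close>, \<open>b\<close>, \<open>c\<close>,
      \<open>d\<close> are substituted, each of the nine entries is a polynomial identity.\<close>
    by (rule mat3_eqI[OF sums BS];
        simp only: idx DS prods entries mat_of_rows_list_3 two derivation_add[OF D]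
          derivation_mult[OF D] assms(2-5); simp add: algebra_simps)
qed

section \<open>Scalar differential identities behind the Darboux transformation\<close>

lemma derivation_sqrt:
  assumes "derivation D" and "s\<^sup>2 = r" and "r \<noteq> 0"
  shows "D s = s * (D r / (2 * r))"
proof -
  have "D r = 2 * s * D s"
    using derivation_mult[OF assms(1), of s s] assms(2) by (simp add: power2_eq_square)
  then show ?thesis using assms(2,3) by (auto simp: power2_eq_square field_simps)
qed

text \<open>The derivative of \<open>D y / y\<close> is
  \<open>D (D y) / y - \<theta>\<^sup>2\<close>, and the second-order equation rewrites the first
  term.\<close>

lemma riccati:
  assumes D: "derivation D" and "y \<noteq> 0" and "D (D y) + p * D y + q * y = 0"
    and \<theta>: "\<theta> = D y / y"
  shows "D \<theta> = - q - p * \<theta> - \<theta>\<^sup>2"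
proof -
  have "D (D y) = - p * D y - q * y"
    using assms(3) by (simp add: algebra_simps eq_neg_iff_add_eq_0)
  then have "D \<theta> = (- p * D y - q * y - \<theta> * D y) / y"
    using assms(2) unfolding \<theta> by (simp add: derivation_divide[OF D])
  moreover have "D y = \<theta> * y"
    using assms(2) \<theta> by simp
  ultimately show ?thesis
    using assms(2) by (simp add: diff_divide_distrib power2_eq_square)
qed

text \<open>The right-hand side is the new potential as read off from the Riccati equation of
  \<open>\<rho>\<close>. The reason is that \<open>- \<rho> - p\<close> is the logarithmic
  derivative of \<open>y * s\<close>, so for \<open>v = 1 / (y * s)\<close> the inner expression
  \<open>p * v - D v\<close> collapses to \<open>- \<rho> * v\<close>.\<close>

lemma darboux_potential:
  assumes D: "derivation D" and "y \<noteq> 0" and "s\<^sup>2 = r" and "r \<noteq> 0"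
    and \<rho>: "\<rho> = - (D y / y) - p - D r / (2 * r)"
  shows "y * s * D (p / (y * s) - D (1 / (y * s))) = - D \<rho> - \<rho>\<^sup>2 - p * \<rho>"
proof -
  have s0: "s \<noteq> 0" using assms by auto
  define v where "v = 1 / (y * s)"
  have v0: "y * s * v = 1" using s0 assms(2) by (simp add: v_def)
  have Dys: "D (y * s) = (- \<rho> - p) * (y * s)"
    using assms(2) s0 unfolding derivation_mult[OF D] derivation_sqrt[OF D assms(3,4)] \<rho>
    by (simp add: algebra_simps)
  have "D v = - v * D (y * s) / (y * s)"
    using assms(2) s0 unfolding v_def by (simp add: derivation_divide[OF D] derivation_1[OF D])
  also have "\<dots> = (\<rho> + p) * v"
    using assms(2) s0 unfolding Dys by (simp add: field_simps)
  finally have Dv: "D v = (\<rho> + p) * v" .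
  have p_v: "p / (y * s) - D (1 / (y * s)) = - (\<rho> * v)"
    using Dv by (simp add: v_def add_divide_distrib algebra_simps)
  have "y * s * D (p / (y * s) - D (1 / (y * s))) = - (D \<rho> + \<rho> * (\<rho> + p)) * (y * s * v)"
    unfolding p_v by (simp add: derivation_minus[OF D] derivation_mult[OF D] Dv algebra_simps)
  then show ?thesis using v0 by (simp add: algebra_simps power2_eq_square)
qed

text \<open>These are the hypotheses of \<open>Sym2_intertwining\<close> for the conjugate of
  \<open>Pm\<close> by \<open>\<Delta>\<close>, with \<open>h = 1 / w\<close>,
  \<open>k = w * (q - m * r)\<close> and \<open>l = w * (qt - m * r)\<close>. They reduce to the
  Riccati equations of \<open>\<theta>\<close> and \<open>\<rho>\<close>; \<open>t\<close> stands
  for the logarithmic derivative of \<open>s\<close>.\<close>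

lemma darboux_intertwining:
  assumes D: "derivation D" and w: "w \<noteq> 0" and Dw: "D w = p * w"
    and s: "s \<noteq> 0" and Ds: "D s = s * t" and Dr: "D r = 2 * r * t"
    and Dm: "D m = 0" and D\<theta>: "D \<theta> = - q - p * \<theta> - \<theta>\<^sup>2"
    and \<rho>: "\<rho> = - \<theta> - p - t" and \<nu>: "\<nu> = m * r - \<rho> * \<theta>"
    and qt: "qt = - D \<rho> - \<rho>\<^sup>2 - p * \<rho>"
  shows "D (- \<theta> / s) = (1 / w) * (w * \<nu> / s) + w * (q - m * r) * (1 / (w * s))"
    and "D (1 / (w * s)) = (1 / w) * (\<rho> / s) - (1 / w) * (- \<theta> / s)"
    and "D (w * \<nu> / s) = w * (q - m * r) * (\<rho> / s) - w * (qt - m * r) * (- \<theta> / s)"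
    and "D (\<rho> / s) = - (w * (qt - m * r)) * (1 / (w * s)) - (1 / w) * (w * \<nu> / s)"
proof -
  \<comment> \<open>Solving for \<open>p\<close> rather than \<open>\<rho>\<close> lets
    \<open>\<rho>\<close> and \<open>D \<rho>\<close> remain atoms in the field arithmetic.\<close>
  have p: "p = - \<theta> - \<rho> - t" using \<rho> by simp
  note D_simps = derivation_divide[OF D] derivation_minus[OF D] derivation_mult[OF D]
    derivation_1[OF D] derivation_diff[OF D]
  have D\<nu>: "D \<nu> = 2 * m * r * t - D \<rho> * \<theta> - \<rho> * (- q - p * \<theta> - \<theta>\<^sup>2)"
    unfolding \<nu> by (simp add: D_simps Dm Dr D\<theta>)
  show "D (- \<theta> / s) = (1 / w) * (w * \<nu> / s) + w * (q - m * r) * (1 / (w * s))"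
    using w s by (simp add: D_simps Ds D\<theta> \<nu> p field_simps power2_eq_square)
  show "D (1 / (w * s)) = (1 / w) * (\<rho> / s) - (1 / w) * (- \<theta> / s)"
    using w s by (simp add: D_simps Ds Dw p field_simps power2_eq_square)
  show "D (w * \<nu> / s) = w * (q - m * r) * (\<rho> / s) - w * (qt - m * r) * (- \<theta> / s)"
    using w s
    \<comment> \<open>\<open>\<nu>\<close> is unfolded only after \<open>D \<nu>\<close> has been
      replaced.\<close>
    by (simp add: D_simps Ds Dw D\<nu> qt) (simp add: \<nu> p field_simps power2_eq_square)
  show "D (\<rho> / s) = - (w * (qt - m * r)) * (1 / (w * s)) - (1 / w) * (w * \<nu> / s)"
    using w s by (simp add: D_simps Ds qt) (simp add: \<nu> p field_simps power2_eq_square)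
qed

section \<open>Invertibility and the transformation of the symmetric square\<close>

lemma mat2_right_inverse:
  fixes a b c d :: "'a::field"
  assumes "a * d - b * c \<noteq> 0"
  shows "mat_of_rows_list 2 [[a, b], [c, d]] *
    mat_of_rows_list 2 [[d / (a * d - b * c), - b / (a * d - b * c)],
                        [- c / (a * d - b * c), a / (a * d - b * c)]] = 1\<^sub>m 2"
proof -
  have "a * (d / (a * d - b * c)) - b * c / (a * d - b * c) = 1"
       "d * a / (a * d - b * c) - c * b / (a * d - b * c) = 1"
    using assms by (simp_all add: divide_simps mult.commute)
  then show ?thesis
    unfolding mult_mat_of_rows_list_2 one_mat_2 by (simp add: algebra_simps)
qed

theorem corollary3p11:
  fixes D :: "'a::field_char_0 \<Rightarrow> 'a"
    and K L :: "'a set"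
    and p q r w y0 sr \<theta>0 qt m \<rho> \<nu> :: 'a
    and Pm \<Delta> P2m :: "'a mat"
  assumes "derivation D"
    and "differential_subfield D K"
    and "alg_closed_subfield (constants D K)"
    and "p \<in> K" and "q \<in> K" and "r \<in> K" and "r \<noteq> 0"
    and "w \<in> K" and "w \<noteq> 0" and "p = D w / w"
    and "picard_vessiot_extension D K L"
    and "y0 \<in> L" and "y0 \<noteq> 0" and "D (D y0) + p * D y0 + q * y0 = 0"
    and "\<theta>0 = D y0 / y0"
    and "sr\<^sup>2 = r"
    and "qt = y0 * sr * D (p / (y0 * sr) - D (1 / (y0 * sr)))"
    and "m \<in> constants D K" and "m \<noteq> 0"
    and "\<rho> = - \<theta>0 - p - D r / (2 * r)"
    and "\<nu> = m * r - \<rho> * \<theta>0"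
    and "Pm = (1 / sr) \<cdot>\<^sub>m mat_of_rows_list 2
           [[- \<theta>0, 1],
            [\<nu>,    \<rho>]]"
    and "\<Delta> = mat_of_rows_list 2
           [[1, 0],
            [0, w]]"
    and "P2m = Sym2 (\<Delta> * Pm * mat_inv \<Delta>)"
  shows "P2m = (1 / r) \<cdot>\<^sub>m mat_of_rows_list 3
           [[\<theta>0\<^sup>2,              - \<theta>0 / w,  1 / w\<^sup>2],
            [- 2 * w * \<theta>0 * \<nu>,  \<nu> - \<rho> * \<theta>0, 2 * \<rho> / w],
            [w\<^sup>2 * \<nu>\<^sup>2,         w * \<rho> * \<nu>,  \<rho>\<^sup>2]]
       \<and> P2m = (1 / r) \<cdot>\<^sub>m
           (mat_of_rows_list 3
             [[0,               0,               1],
              [0,               w * m * r,       2 * w * \<rho>],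
              [w\<^sup>2 * m\<^sup>2 * r\<^sup>2, w\<^sup>2 * \<rho> * m * r, w\<^sup>2 * \<rho>\<^sup>2]]
            * mat_of_rows_list 3
             [[1,        0,         0],
              [- 2 * \<theta>0, 1 / w,     0],
              [\<theta>0\<^sup>2,     - \<theta>0 / w, 1 / w\<^sup>2]])
       \<and> invertible_mat P2m
       \<and> gauge_transform D P2m (sym2_system w q r m) = sym2_system w qt r m
       \<and> (\<forall>Y\<in>carrier_vec 3.
             is_solution D (sym2_system w q r m) Y
             \<longleftrightarrow> is_solution D (sym2_system w qt r m) (P2m *\<^sub>v Y))"
proof -
  note D = assms(1) and r = assms(7) and w = assms(9) and sr = assms(16)
  have s: "sr \<noteq> 0" using r sr by auto
  have Dm: "D m = 0" using assms(18) by (simp add: constants_def)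
  have Dw: "D w = p * w" using assms(10) w by simp
  have Dr: "D r = 2 * r * (D r / (2 * r))" using r by simp
  \<comment> \<open>\<open>M\<close> is the conjugate of \<open>Pm\<close> by
    \<open>\<Delta>\<close>, which passes from the unknowns \<open>(y, y')\<close> to
    \<open>(y, w * y')\<close>.\<close>
  define M where "M = mat_of_rows_list 2 [[- \<theta>0 / sr, 1 / (w * sr)], [w * \<nu> / sr, \<rho> / sr]]"
  have M: "M \<in> carrier_mat 2 2" by (simp add: M_def mat_of_rows_list_2)

  have \<Delta>_inv: "mat_inv \<Delta> = mat_of_rows_list 2 [[1, 0], [0, 1 / w]]"
    unfolding assms(23) using w
    by (intro mat_inv_eqI[of _ 2])
      (simp_all add: mat_of_rows_list_2 mult_mat_of_rows_list_2 one_mat_2)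
  have Pm: "Pm = mat_of_rows_list 2 [[- \<theta>0 / sr, 1 / sr], [\<nu> / sr, \<rho> / sr]]"
    unfolding assms(22)
    by (rule mat2_eqI) (simp_all add: mat_of_rows_list_def numeral_2_eq_2)
  have P2m: "P2m = Sym2 M"
    unfolding assms(24) \<Delta>_inv unfolding Pm assms(23) mult_mat_of_rows_list_2 M_def
    using w by (simp add: mult.commute)
  have P: "P2m \<in> carrier_mat 3 3" by (simp add: P2m Sym2_carrier)

  \<comment> \<open>\<open>Sym2\<close> is quadratic in the entries, so the common factor
    \<open>1 / sr\<close> of \<open>M\<close> contributes exactly \<open>1 / r\<close>.\<close>
  have explicit: "P2m = (1 / r) \<cdot>\<^sub>m mat_of_rows_list 3
           [[\<theta>0\<^sup>2,              - \<theta>0 / w,  1 / w\<^sup>2],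
            [- 2 * w * \<theta>0 * \<nu>,  \<nu> - \<rho> * \<theta>0, 2 * \<rho> / w],
            [w\<^sup>2 * \<nu>\<^sup>2,         w * \<rho> * \<nu>,  \<rho>\<^sup>2]]" (is "_ = _ \<cdot>\<^sub>m ?E")
    unfolding P2m M_def Sym2_mat_of_rows_list sr[symmetric]
    using s w
    by (intro mat3_eqI)
      (simp_all add: mat_of_rows_list_def numeral_2_eq_2 numeral_3_eq_3 field_simps)

  \<comment> \<open>The two factors are the symmetric squares of
    \<open>(0, 1; w * m * r, w * \<rho>)\<close> and \<open>(1, 0; - \<theta>0, 1 / w)\<close>,
    whose product is \<open>sr\<close> times \<open>M\<close>.\<close>
  have factored: "?E = mat_of_rows_list 3
             [[0,               0,               1],
              [0,               w * m * r,       2 * w * \<rho>],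
              [w\<^sup>2 * m\<^sup>2 * r\<^sup>2, w\<^sup>2 * \<rho> * m * r, w\<^sup>2 * \<rho>\<^sup>2]]
            * mat_of_rows_list 3
             [[1,        0,         0],
              [- 2 * \<theta>0, 1 / w,     0],
              [\<theta>0\<^sup>2,     - \<theta>0 / w, 1 / w\<^sup>2]]"
    unfolding assms(21) using w
    by (intro mat3_eqI)
      (simp_all add: mult_mat_3_index mult_carrier_mat[of _ 3 3] mat_of_rows_list_3[simplified]
        field_simps power2_eq_square del: index_mult_mat)

  \<comment> \<open>The determinant is \<open>- (\<theta>0 * \<rho> + \<nu>) / r\<close>; the choice
    of \<open>\<nu>\<close> cancels \<open>\<rho> * \<theta>0\<close> and leaves \<open>- m\<close>,
    which is where \<open>m \<noteq> 0\<close> enters.\<close>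
  have "(- \<theta>0 / sr) * (\<rho> / sr) - (1 / (w * sr)) * (w * \<nu> / sr) = - m"
    using w s unfolding assms(21) sr[symmetric] by (simp add: field_simps power2_eq_square)
  then have det: "(- \<theta>0 / sr) * (\<rho> / sr) - (1 / (w * sr)) * (w * \<nu> / sr) \<noteq> 0"
    using assms(19) by simp
  obtain N where N: "N \<in> carrier_mat 2 2" and MN: "M * N = 1\<^sub>m 2"
    using mat2_right_inverse[OF det, folded M_def] by (rule that[OF mat_of_rows_list_2(1)])
  have PN: "P2m * Sym2 N = 1\<^sub>m 3"
    unfolding P2m Sym2_mult[OF M N, symmetric] MN by (rule Sym2_one)
  have inv: "invertible_mat P2m"
    using P PN mat_mult_left_right_inverse[OF P Sym2_carrier PN] Sym2_carrier[of N]
    unfolding invertible_mat_def inverts_mat_def by (auto intro!: exI[of _ "Sym2 N"])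

  have "qt = - D \<rho> - \<rho>\<^sup>2 - p * \<rho>"
    unfolding assms(17)
    by (rule darboux_potential[OF D assms(13) sr r]) (simp add: assms(15,20))
  note entries = darboux_intertwining[OF D w Dw s derivation_sqrt[OF D sr r] Dr Dm
      riccati[OF D assms(13,14,15)] assms(20,21) this]
  have intertwining: "map_mat D P2m + P2m * sym2_system w q r m = sym2_system w qt r m * P2m"
    unfolding P2m M_def sym2_system_eq by (rule Sym2_intertwining[OF D entries])

  have carrier: "sym2_system w q' r m \<in> carrier_mat 3 3" for q'
    by (simp add: sym2_system_eq mat_of_rows_list_3)
  have "gauge_transform D P2m (sym2_system w q r m) = sym2_system w qt r m"
    by (rule gauge_transform_eqI[OF P Sym2_carrier PN carrier intertwining])
  moreover have "\<forall>Y\<in>carrier_vec 3. is_solution D (sym2_system w q r m) Y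
      \<longleftrightarrow> is_solution D (sym2_system w qt r m) (P2m *\<^sub>v Y)"
    using is_solution_gauge_iff[OF D P Sym2_carrier PN carrier carrier intertwining] by blast
  ultimately show ?thesis
    using explicit factored inv by simp
qed

end
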